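(* Let $\mathbb{K}=\mathbb{R}$ or $\mathbb{K}=\mathbb{C}$, $A\in Gl(d,\mathbb{K})$, $B\in\mathbb{K}^{d\times m}$, and let $U\subset\mathbb{K}^m$ be a compact convex neighborhood of $0$ with $U=\overline{\mathrm{int}\,U}$. Consider the control system $x_{k+1}=Ax_k+Bu_k$, $u_k\in U$, $k\in\mathbb{N}_0$, in $\mathbb{K}^d$. (i) $\mathbf{R}(0)=\mathbb{K}^d$ if and only if $(A,B)$ is controllable and $A$ has no eigenvalues with absolute value less than $1$. (ii) $\mathbf{C}(0)=\mathbb{K}^d$ if and only if $(A,B)$ is controllable and $A$ has no eigenvalues with absolute value greater than $1$. (iii) The system is controllable in $\mathbb{K}^d$ (i.e. for all $x,y\in\mathbb{K}^d$ there are $u\in\mathcal{U}$ and $k\in\mathbb{N}$ with $\varphi(k,x,u)=y$) if and only if $(A,B)$ is controllable and all eigenvalues of $A$ have absolute value equal to $1$.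
   Context: $\mathbb{N}=\{1,2,\dots\}$, $\mathbb{N}_0=\{0,1,2,\dots\}$, $\mathcal{U}=U^{\mathbb{N}_0}$. For $x\in\mathbb{K}^d$, $u=(u_i)\in\mathcal{U}$ the solution is $\varphi(k,x,u)=A^kx+\sum_{i=0}^{k-1}A^{k-1-i}Bu_i$. $\mathbf{R}(0)=\{\varphi(k,0,u)\mid k\in\mathbb{N},u\in\mathcal{U}\}$ and $\mathbf{C}(0)=\{y\in\mathbb{K}^d\mid\exists k\in\mathbb{N},u\in\mathcal{U}:\varphi(k,y,u)=0\}$. The pair $(A,B)$ is controllable if $\mathrm{rank}[B\ AB\ \cdots\ A^{d-1}B]=d$ (equivalently, the system without control restriction is controllable). For $\mathbb{K}=\mathbb{R}$, eigenvalues of $A$ are understood as complex eigenvalues. *)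

theory Defs
  imports "HOL-Analysis.Analysis"
begin

text \<open>
  The field is \<open>real\<close> or \<open>complex\<close>; the dimensions \<open>d\<close> and \<open>m\<close> are the cardinalities of the
  index types \<open>'d\<close> and \<open>'m\<close>.
\<close>

text \<open>The type class power \<open>A ^ k\<close> on vectors is componentwise, hence a separate matrix power.\<close>

primrec mat_power :: "'k::semiring_1^'d^'d \<Rightarrow> nat \<Rightarrow> 'k^'d^'d" where
  "mat_power A 0 = mat 1"
| "mat_power A (Suc k) = A ** mat_power A k"

definition control_seqs :: "('k^'m) set \<Rightarrow> (nat \<Rightarrow> 'k^'m) set" where
  "control_seqs U = UNIV \<rightarrow> U"

definition solution ::
  "'k::field^'d^'d \<Rightarrow> 'k^'m^'d \<Rightarrow> nat \<Rightarrow> 'k^'d \<Rightarrow> (nat \<Rightarrow> 'k^'m) \<Rightarrow> 'k^'d" where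
  "solution A B k x u =
     mat_power A k *v x + (\<Sum>i<k. mat_power A (k - 1 - i) *v (B *v u i))"

text \<open>Times range over the positive integers in the following three definitions.\<close>

definition reachable_set :: "'k::field^'d^'d \<Rightarrow> 'k^'m^'d \<Rightarrow> ('k^'m) set \<Rightarrow> ('k^'d) set" where
  "reachable_set A B U = {solution A B k 0 u | k u. k \<ge> 1 \<and> u \<in> control_seqs U}"

definition null_controllable_set ::
  "'k::field^'d^'d \<Rightarrow> 'k^'m^'d \<Rightarrow> ('k^'m) set \<Rightarrow> ('k^'d) set" where
  "null_controllable_set A B U =
     {y. \<exists>k\<ge>1. \<exists>u\<in>control_seqs U. solution A B k y u = 0}"

definition system_controllable :: "'k::field^'d^'d \<Rightarrow> 'k^'m^'d \<Rightarrow> ('k^'m) set \<Rightarrow> bool" where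
  "system_controllable A B U \<longleftrightarrow>
     (\<forall>x y. \<exists>u\<in>control_seqs U. \<exists>k\<ge>1. solution A B k x u = y)"

text \<open>
  The \<open>d\<close> blocks \<open>B, AB, \<dots>, A\<^sup>d\<^sup>-\<^sup>1B\<close> are indexed by the type \<open>'d\<close>, enumerated by an arbitrary
  bijection onto \<open>{0, \<dots>, d - 1}\<close>. Another enumeration only permutes the blocks, so the rank
  does not depend on it. A column of the block matrix is a pair (block, column of \<open>B\<close>).
\<close>

definition block_exponent :: "'d::finite \<Rightarrow> nat" where
  "block_exponent = (SOME f. bij_betw f UNIV {..<CARD('d)})"

lemma bij_betw_block_exponent:
  "bij_betw (block_exponent :: 'd::finite \<Rightarrow> nat) UNIV {..<CARD('d)}"
proof -
  have "\<exists>f. bij_betw f (UNIV :: 'd set) {..<CARD('d)}"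
    using ex_bij_betw_finite_nat[of "UNIV :: 'd set"] by (simp add: atLeast0LessThan)
  then show ?thesis
    unfolding block_exponent_def by (rule someI_ex)
qed

definition kalman_matrix :: "'k::field^'d^'d \<Rightarrow> 'k^'m^'d \<Rightarrow> 'k^('d \<times> 'm)^'d" where
  "kalman_matrix A B = (\<chi> i p. (mat_power A (block_exponent (fst p)) ** B) $ i $ snd p)"

definition controllable_pair :: "'k::field^'d^'d \<Rightarrow> 'k^'m^'d \<Rightarrow> bool" where
  "controllable_pair A (B :: 'k^'m^'d) \<longleftrightarrow> rank (kalman_matrix A B) = CARD('d)"

definition is_eigenvalue :: "'k::field^'d^'d \<Rightarrow> 'k \<Rightarrow> bool" where
  "is_eigenvalue A \<mu> \<longleftrightarrow> (\<exists>v. v \<noteq> 0 \<and> A *v v = \<mu> *s v)"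

abbreviation complexify :: "real^'n^'m \<Rightarrow> complex^'n^'m" where
  "complexify \<equiv> map_matrix complex_of_real"

end

theory Submission
  imports Defs "HOL-Computational_Algebra.Fundamental_Theorem_Algebra"
begin

text \<open>
  The reachable set \<open>R\<close> is convex, so it fails to be the whole space iff some nonzero functional
  \<open>\<xi>\<close> is bounded above on it. As \<open>U\<close> is bounded and contains a ball around \<open>0\<close>, this happens iff
  \<open>\<Sum>j. \<bar>\<xi> A\<^sup>j B\<bar>\<close> converges. Over the complex numbers the functionals with this property form an
  \<open>A\<close>-invariant subspace, so if it is nonzero it contains a left eigenvector \<open>v A = \<mu> v\<close>, for which
  the sum is a geometric series: either \<open>v B = 0\<close>, which by the Hautus test means that \<open>(A, B)\<close> is
  not controllable, or \<open>\<bar>\<mu>\<bar> < 1\<close>. The real case follows by taking real and imaginary parts.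
  Reversing time turns null controllability into reachability for \<open>(A\<^sup>-\<^sup>1, A\<^sup>-\<^sup>1 B)\<close> with controls in
  \<open>- U\<close>, and controllability means steering through \<open>0\<close>.
\<close>

section \<open>Matrix powers and row vectors\<close>

lemma mat_power_Suc_right: "mat_power A (Suc k) = mat_power A k ** A"
  by (induction k) (simp_all add: matrix_mul_assoc)

lemma mat_power_add: "mat_power A (k + l) = mat_power A k ** mat_power A l"
  by (induction k) (simp_all add: matrix_mul_assoc[symmetric])

lemma mat_power_inverse:
  fixes A :: "'k::field^'d^'d"
  assumes "A' ** A = mat 1"
  shows "mat_power A' k ** mat_power A k = mat 1"
proof (induction k)
  case (Suc k)
  have "mat_power A' (Suc k) ** mat_power A (Suc k)
      = mat_power A' k ** ((A' ** A) ** mat_power A k)"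
    unfolding mat_power_Suc_right[of A'] mat_power.simps(2)[of A] by (simp only: matrix_mul_assoc)
  then show ?case using Suc assms by simp
qed simp

lemma vector_matrix_mult_scale:
  fixes x :: "'k::field^'n"
  shows "(c *s x) v* M = c *s (x v* M)"
  by (simp add: vec_eq_iff vector_matrix_mult_def sum_distrib_left ac_simps)

lemma vector_matrix_mult_sum:
  fixes x :: "'i \<Rightarrow> 'k::field^'n"
  shows "(\<Sum>i\<in>I. x i) v* M = (\<Sum>i\<in>I. x i v* M)"
  by (induction I rule: infinite_finite_induct) (simp_all add: vector_matrix_left_distrib)

lemma norm_vector_scalar_mult:
  fixes c :: "'k::real_normed_field"
  shows "norm (c *s x) = norm c * norm x"
  by (simp add: norm_vec_def norm_mult L2_set_right_distrib)

lemma left_eigenvector_mat_power: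
  fixes A :: "'k::field^'d^'d"
  assumes "v v* A = \<mu> *s v"
  shows "v v* mat_power A k = \<mu> ^ k *s v"
proof (induction k)
  case (Suc k)
  have "v v* mat_power A (Suc k) = (v v* A) v* mat_power A k"
    by (simp add: vector_matrix_mul_assoc)
  also have "\<dots> = \<mu> ^ Suc k *s v"
    by (simp add: assms vector_matrix_mult_scale Suc)
  finally show ?case .
qed simp

text \<open>A square matrix and its transpose are invertible together, and trivial kernel means
  invertible; this is applied to \<open>A - mat \<mu>\<close>. Eigenvalues are defined with columns,
  while the functionals studied below act as rows.\<close>

lemma is_eigenvalue_iff_left:
  fixes A :: "'k::field^'d^'d"
  shows "is_eigenvalue A \<mu> \<longleftrightarrow> (\<exists>v. v \<noteq> 0 \<and> v v* A = \<mu> *s v)"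
proof -
  let ?C = "A - mat \<mu>"
  have mat: "mat \<mu> *v v = \<mu> *s v" "v v* mat \<mu> = \<mu> *s v" for v :: "'k^'d"
    by (simp_all add: vec_eq_iff matrix_vector_mult_def vector_matrix_mult_def mat_def
        if_distrib[of "\<lambda>x. x * _"] if_distrib[of "\<lambda>x. _ * x"] mult.commute cong: if_cong)
  have "(\<forall>v. ?C *v v = 0 \<longrightarrow> v = 0) \<longleftrightarrow> (\<exists>B. ?C ** B = mat 1)"
    by (metis matrix_left_invertible_ker matrix_left_right_inverse)
  also have "\<dots> \<longleftrightarrow> (\<forall>v. transpose ?C *v v = 0 \<longrightarrow> v = 0)"
    by (metis matrix_left_invertible_ker left_invertible_transpose)
  finally show ?thesis
    unfolding is_eigenvalue_def
    by (auto simp: matrix_vector_mult_diff_rdistrib vector_matrix_mult_diff_rdistrib mat)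
qed

section \<open>Left eigenvectors in Krylov spaces\<close>

text \<open>The \<open>d + 1\<close> rows \<open>x, x A, ..., x A^d\<close> cannot be independent in
  dimension \<open>d\<close>; a linear relation between them supplies the coefficients of
  \<open>p\<close>.\<close>

lemma krylov_annihilating_poly:
  fixes A :: "'k::field^'n^'n" and x :: "'k^'n"
  shows "\<exists>p. p \<noteq> 0 \<and> degree p \<le> CARD('n) \<and>
    (\<Sum>i\<le>CARD('n). coeff p i *s (x v* mat_power A i)) = 0"
proof -
  let ?f = "\<lambda>i. x v* mat_power A i" and ?I = "{..CARD('n)}"
  show ?thesis
  \<comment> \<open>Dependence is a property of sets and does not see repetitions. A repetition
    \<open>x A^i = x A^j\<close> is therefore treated apart and gives
    \<open>X^i - X^j\<close>.\<close>
  proof (cases "inj_on ?f ?I")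
    case True
    then have "card (?f ` ?I) = Suc CARD('n)"
      by (simp add: card_image)
    then have "vec.dependent (?f ` ?I)"
      using vec.independent_bound_general[of "?f ` ?I"] vec.dim_subset_UNIV[of "?f ` ?I"]
      by (auto simp: vec.dimension_def card_cart_basis)
    then obtain u w where uw: "w \<in> ?f ` ?I" "u w \<noteq> 0" "(\<Sum>v\<in>?f ` ?I. u v *s v) = 0"
      by (auto simp: vec.dependent_finite)
    then obtain j where j: "j \<in> ?I" "u (?f j) \<noteq> 0" by auto
    have sum0: "(\<Sum>i\<in>?I. u (?f i) *s ?f i) = 0"
      using uw(3) by (simp add: sum.reindex[OF True])
    define p where "p = (\<Sum>i\<in>?I. monom (u (?f i)) i)"
    have coeff: "coeff p i = (if i \<in> ?I then u (?f i) else 0)" for i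
      by (auto simp: p_def coeff_sum if_distrib cong: if_cong)
    have "p \<noteq> 0" using j coeff[of j] by auto
    moreover have "degree p \<le> CARD('n)"
      by (rule degree_le) (simp add: coeff)
    moreover have "(\<Sum>i\<le>CARD('n). coeff p i *s ?f i) = 0"
      using sum0 by (simp add: coeff)
    ultimately show ?thesis by blast
  next
    case False
    then obtain i j where ij: "i \<in> ?I" "j \<in> ?I" "i \<noteq> j" "?f i = ?f j"
      by (auto simp: inj_on_def)
    define p where "p = monom (1::'k) i - monom 1 j"
    have "coeff p i \<noteq> 0" using ij by (simp add: p_def)
    then have "p \<noteq> 0" by auto
    moreover have "degree p \<le> CARD('n)"
      by (rule degree_le) (use ij in \<open>auto simp: p_def\<close>)
    moreover have "(\<Sum>k\<le>CARD('n). coeff p k *s ?f k)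
        = (\<Sum>k\<in>?I. (if k = i then ?f k else 0) - (if k = j then ?f k else 0))"
      by (intro sum.cong) (auto simp: p_def)
    then have "(\<Sum>k\<le>CARD('n). coeff p k *s ?f k) = 0"
      using ij by (simp add: sum_subtractf)
    ultimately show ?thesis by blast
  qed
qed

text \<open>
  If \<open>p = (X - \<lambda>) q\<close> has minimal degree among the polynomials with \<open>x p(A) = 0\<close>, then \<open>x q(A)\<close> is
  a left eigenvector. The bound \<open>deg q < d\<close> is what makes the \<open>d\<close> blocks of the Kalman matrix enough.
\<close>

lemma krylov_left_eigenvector:
  fixes A :: "complex^'n^'n"
  assumes "x \<noteq> 0"
  obtains q \<mu> v where "v = (\<Sum>i<CARD('n). q i *s (x v* mat_power A i))" "v \<noteq> 0" "v v* A = \<mu> *s v"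
proof -
  let ?n = "CARD('n)"
  define ev where "ev p = (\<Sum>i\<le>?n. coeff p i *s (x v* mat_power A i))" for p
  define P where "P p \<longleftrightarrow> p \<noteq> 0 \<and> degree p \<le> ?n \<and> ev p = 0" for p
  have "\<exists>p. P p"
    using krylov_annihilating_poly[of x A] by (simp add: P_def ev_def)
  then obtain p where p: "P p" and min: "\<And>q. P q \<Longrightarrow> degree p \<le> degree q"
    using ex_has_least_nat[of P _ degree] by blast
  \<comment> \<open>A nonzero constant \<open>c\<close> would give \<open>ev p = c x\<close>, which
    is not \<open>0\<close>. So \<open>p\<close> is not constant and has a complex root.\<close>
  have "degree p \<noteq> 0"
  proof
    assume "degree p = 0"
    then obtain c where "p = [:c:]" by (auto elim: degree_eq_zeroE)
    then have "ev p = c *s x"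
      by (simp add: ev_def coeff_pCons sum.atMost_shift del: sum.atMost_Suc)
    with p \<open>p = [:c:]\<close> \<open>x \<noteq> 0\<close> show False by (auto simp: P_def)
  qed
  then obtain \<mu> where "poly p \<mu> = 0"
    using fundamental_theorem_of_algebra[of p] constant_degree[of p] by auto
  then obtain q where pq: "p = [:-\<mu>, 1:] * q"
    by (auto simp: poly_eq_0_iff_dvd)
  with p have "q \<noteq> 0" by (auto simp: P_def)
  then have deg: "degree p = Suc (degree q)"
    unfolding pq by (subst degree_mult_eq) simp_all
  then have qn: "degree q < ?n" using p by (simp add: P_def)
  define v where "v = (\<Sum>i<?n. coeff q i *s (x v* mat_power A i))"
  have ev_q: "ev q = v"
    using qn by (simp add: ev_def v_def lessThan_Suc_atMost[symmetric] coeff_eq_0)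
  have "v \<noteq> 0"
    using min[of q] \<open>q \<noteq> 0\<close> qn deg ev_q by (auto simp: P_def)
  \<comment> \<open>Expand \<open>p = X q - \<mu> q\<close>. The factor \<open>X\<close> shifts the
    index by one, which amounts to a factor \<open>A\<close> on the right, so
    \<open>0 = ev p\<close> becomes \<open>0 = v A - \<mu> v\<close>.\<close>
  have "ev p = (\<Sum>i\<le>?n. coeff (pCons 0 q) i *s (x v* mat_power A i)) - \<mu> *s ev q"
    by (simp add: ev_def pq sum_subtractf[symmetric] vec.scale_sum_right vec.scale_left_diff_distrib)
  also have "(\<Sum>i\<le>?n. coeff (pCons 0 q) i *s (x v* mat_power A i))
      = (\<Sum>i<?n. coeff q i *s (x v* mat_power A (Suc i)))"
    by (simp add: sum.atMost_shift del: mat_power.simps)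
  also have "\<dots> = v v* A"
    by (simp add: v_def vector_matrix_mult_sum vector_matrix_mult_scale vector_matrix_mul_assoc
        mat_power_Suc_right del: mat_power.simps)
  finally have "v v* A = \<mu> *s v"
    using p ev_q by (simp add: P_def)
  with v_def \<open>v \<noteq> 0\<close> show ?thesis by (rule that)
qed

section \<open>The Kalman rank condition and the Hautus test\<close>

text \<open>The rows of \<open>K\<close> are the images of the standard basis under the map
  \<open>x \<mapsto> x K\<close>, so the row space is the range of this map and has full dimension
  exactly when the map is injective.\<close>

lemma full_row_rank_iff:
  fixes K :: "'k::field^'n^'m"
  shows "rank K = CARD('m) \<longleftrightarrow> (\<forall>x. x v* K = 0 \<longrightarrow> x = 0)"
proof -
  let ?f = "(*v) (transpose K)"
  have row: "transpose K *v axis i 1 = row i K" for i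
    by (simp add: vec_eq_iff vector_matrix_mult_def row_def axis_def
        if_distrib[of "\<lambda>x. x * _"] cong: if_cong)
  have rows: "rows K = ?f ` cart_basis"
    unfolding rows_def cart_basis_def Setcompr_eq_image image_image row ..
  show ?thesis
  proof
    assume rank: "rank K = CARD('m)"
    have dim: "vec.dim (?f ` cart_basis) = CARD('m)"
      using rank by (simp add: row_rank_def_gen rows)
    \<comment> \<open>Dimension \<open>\<le>\<close> number of distinct rows \<open>\<le>\<close>
      \<open>CARD('m)\<close>. Full rank forces equality throughout, so the rows are pairwise
      distinct and independent.\<close>
    have "vec.dim (?f ` cart_basis) \<le> card (?f ` cart_basis)"
      by (rule vec.dim_le_card) (simp_all add: vec.span_superset finite_cart_basis)
    moreover have "card (?f ` cart_basis) \<le> CARD('m)"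
      using card_image_le[OF finite_cart_basis, of ?f] by (simp only: card_cart_basis)
    ultimately have card: "card (?f ` cart_basis) = CARD('m)" using dim by simp
    then have "vec.independent (?f ` cart_basis)"
      using vec.card_eq_dim[of "?f ` cart_basis" "?f ` cart_basis"] dim
      by (simp add: vec.span_superset finite_cart_basis)
    moreover have "inj_on ?f cart_basis"
      using card by (intro eq_card_imp_inj_on) (simp_all add: finite_cart_basis card_cart_basis)
    ultimately have "inj_on ?f (vec.span cart_basis)"
      using vec.inj_on_span_iff_independent_image by blast
    then have "inj ?f" by simp
    then show "\<forall>x. x v* K = 0 \<longrightarrow> x = 0"
      by (simp add: vec.inj_iff_eq_0)
  next
    assume "\<forall>x. x v* K = 0 \<longrightarrow> x = 0"
    then have "inj ?f" by (simp add: vec.inj_iff_eq_0)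
    then have "vec.dim (?f ` cart_basis) = vec.dim (cart_basis :: ('k^'m) set)"
      by (intro vec.dim_image_eq) (auto intro: inj_on_subset)
    then show "rank K = CARD('m)"
      by (simp add: row_rank_def_gen rows card_cart_basis vec.dim_eq_card_independent independent_cart_basis)
  qed
qed

text \<open>The entries of \<open>x v* kalman_matrix A B\<close> are those of all the rows
  \<open>x A^j B\<close>, and \<open>block_exponent\<close> hits every \<open>j < d\<close>, so the
  chosen enumeration drops out.\<close>

lemma controllable_pair_iff:
  fixes A :: "'k::field^'d^'d" and B :: "'k^'m^'d"
  shows "controllable_pair A B \<longleftrightarrow>
    (\<forall>x. (\<forall>j<CARD('d). x v* (mat_power A j ** B) = 0) \<longrightarrow> x = 0)"
proof -
  have comp: "(x v* kalman_matrix A B) $ p = (x v* (mat_power A (block_exponent (fst p)) ** B)) $ snd p"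
    for x p
    by (simp add: kalman_matrix_def vector_matrix_mult_def)
  have range: "range (block_exponent :: 'd \<Rightarrow> nat) = {..<CARD('d)}"
    using bij_betw_block_exponent by (auto simp: bij_betw_def)
  have "x v* kalman_matrix A B = 0 \<longleftrightarrow>
      (\<forall>j\<in>range (block_exponent :: 'd \<Rightarrow> nat). x v* (mat_power A j ** B) = 0)" for x
    by (simp add: vec_eq_iff comp)
  then show ?thesis
    unfolding range by (simp add: controllable_pair_def full_row_rank_iff Ball_def)
qed

text \<open>A left eigenvector killing \<open>B\<close> kills every \<open>A^j B\<close>, because
  \<open>v A^j B = \<mu>^j v B\<close>. Conversely, if \<open>x\<close> kills the first
  \<open>d\<close> blocks, its Krylov eigenvector combines only \<open>x A^i\<close> with
  \<open>i < d\<close> and hence kills \<open>B\<close>.\<close>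

lemma hautus:
  fixes A :: "complex^'d^'d" and B :: "complex^'m^'d"
  shows "controllable_pair A B \<longleftrightarrow>
    (\<nexists>v \<mu>. v \<noteq> 0 \<and> v v* A = \<mu> *s v \<and> v v* B = 0)"
proof -
  have False if "v \<noteq> 0" "v v* A = \<mu> *s v" "v v* B = 0" "controllable_pair A B" for v \<mu>
  proof -
    have "v v* (mat_power A j ** B) = 0" for j
      using that by (simp add: vector_matrix_mul_assoc[symmetric] left_eigenvector_mat_power
          vector_matrix_mult_scale)
    with that show False by (auto simp: controllable_pair_iff)
  qed
  moreover have "\<exists>v \<mu>. v \<noteq> 0 \<and> v v* A = \<mu> *s v \<and> v v* B = 0" if nc: "\<not> controllable_pair A B"
  proof -
    obtain x where x: "x \<noteq> 0" "\<forall>j<CARD('d). x v* (mat_power A j ** B) = 0"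
      using nc by (auto simp: controllable_pair_iff)
    obtain q \<mu> v where v: "v = (\<Sum>i<CARD('d). q i *s (x v* mat_power A i))" "v \<noteq> 0" "v v* A = \<mu> *s v"
      using krylov_left_eigenvector[OF x(1)] .
    then have "v v* B = 0"
      using x(2) by (simp add: vector_matrix_mult_sum vector_matrix_mult_scale vector_matrix_mul_assoc)
    with v show ?thesis by blast
  qed
  ultimately show ?thesis by blast
qed

section \<open>Absolutely summable output functionals\<close>

lemma ex_summable_iff_ex_left_eigenvector:
  fixes A :: "complex^'d^'d" and B :: "complex^'m^'d"
  shows "(\<exists>x. x \<noteq> 0 \<and> summable (\<lambda>j. norm (x v* (mat_power A j ** B)))) \<longleftrightarrow>
    (\<exists>v \<mu>. v \<noteq> 0 \<and> v v* A = \<mu> *s v \<and> (v v* B = 0 \<or> cmod \<mu> < 1))"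
proof -
  have eig: "norm (v v* (mat_power A j ** B)) = cmod \<mu> ^ j * norm (v v* B)"
    if "v v* A = \<mu> *s v" for v \<mu> j
    by (simp add: vector_matrix_mul_assoc[symmetric] left_eigenvector_mat_power[OF that]
        vector_matrix_mult_scale norm_vector_scalar_mult norm_power)
  have summable: "summable (\<lambda>j. norm (v v* (mat_power A j ** B))) \<longleftrightarrow> v v* B = 0 \<or> cmod \<mu> < 1"
    if "v v* A = \<mu> *s v" for v \<mu>
    by (auto simp: eig[OF that] mult.commute[of "cmod \<mu> ^ _"] summable_geometric_iff)
  have "\<exists>v \<mu>. v \<noteq> 0 \<and> v v* A = \<mu> *s v \<and> (v v* B = 0 \<or> cmod \<mu> < 1)"
    if x: "x \<noteq> 0" "summable (\<lambda>j. norm (x v* (mat_power A j ** B)))" for x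
  proof -
    obtain q \<mu> v where v: "v = (\<Sum>i<CARD('d). q i *s (x v* mat_power A i))" "v \<noteq> 0" "v v* A = \<mu> *s v"
      using krylov_left_eigenvector[OF x(1)] .
    \<comment> \<open>Powers of \<open>A\<close> commute, so the output sequence of \<open>v\<close>
      is a finite combination of shifts of that of \<open>x\<close> and inherits its
      summability.\<close>
    have "v v* (mat_power A j ** B) = (\<Sum>i<CARD('d). q i *s (x v* (mat_power A (j + i) ** B)))" for j
      by (simp add: v(1) vector_matrix_mult_sum vector_matrix_mult_scale vector_matrix_mul_assoc
          mat_power_add matrix_mul_assoc add.commute[of j])
    then have bound: "norm (v v* (mat_power A j ** B))
        \<le> (\<Sum>i<CARD('d). cmod (q i) * norm (x v* (mat_power A (j + i) ** B)))" for j
      by (simp add: norm_vector_scalar_mult[symmetric] norm_sum)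
    have majorant: "summable (\<lambda>j. \<Sum>i<CARD('d). cmod (q i) * norm (x v* (mat_power A (j + i) ** B)))"
      by (intro summable_sum summable_mult summable_ignore_initial_segment x(2))
    have "summable (\<lambda>j. norm (v v* (mat_power A j ** B)))"
      by (rule summable_comparison_test'[OF majorant, where N = 0]) (simp add: bound)
    with v summable[OF v(3)] show ?thesis by blast
  qed
  with summable show ?thesis by blast
qed

lemma no_summable_iff_complex:
  fixes A :: "complex^'d^'d" and B :: "complex^'m^'d"
  shows "(\<nexists>x. x \<noteq> 0 \<and> summable (\<lambda>j. norm (x v* (mat_power A j ** B)))) \<longleftrightarrow>
    controllable_pair A B \<and> (\<nexists>\<mu>. is_eigenvalue A \<mu> \<and> cmod \<mu> < 1)"
  unfolding ex_summable_iff_ex_left_eigenvector hautus is_eigenvalue_iff_left by auto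

section \<open>Complexification\<close>

lemma complexify_mult: "complexify (M ** N) = complexify M ** complexify N"
  by (simp add: vec_eq_iff matrix_matrix_mult_def)

lemma complexify_mat_1: "complexify (mat 1) = mat 1"
  by (simp add: vec_eq_iff mat_def)

lemma complexify_mat_power: "complexify (mat_power A k) = mat_power (complexify A) k"
  by (induction k) (simp_all add: complexify_mult complexify_mat_1)

definition cvec :: "real^'n \<Rightarrow> complex^'n" where
  "cvec x = (\<chi> i. complex_of_real (x $ i))"

definition Re_vec :: "complex^'n \<Rightarrow> real^'n" where
  "Re_vec z = (\<chi> i. Re (z $ i))"

definition Im_vec :: "complex^'n \<Rightarrow> real^'n" where
  "Im_vec z = (\<chi> i. Im (z $ i))"

lemma cvec_eq_0_iff [simp]: "cvec x = 0 \<longleftrightarrow> x = 0"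
  by (simp add: cvec_def vec_eq_iff)

lemma Re_Im_vec_eq_0: "Re_vec z = 0 \<Longrightarrow> Im_vec z = 0 \<Longrightarrow> z = 0"
  by (simp add: Re_vec_def Im_vec_def vec_eq_iff complex_eq_iff)

lemma norm_cvec [simp]: "norm (cvec x) = norm x"
  by (simp add: cvec_def norm_vec_def)

lemma norm_Re_vec_le: "norm (Re_vec z) \<le> norm z"
  by (simp add: Re_vec_def norm_vec_def L2_set_mono abs_Re_le_cmod)

lemma norm_Im_vec_le: "norm (Im_vec z) \<le> norm z"
  by (simp add: Im_vec_def norm_vec_def L2_set_mono abs_Im_le_cmod)

lemma vector_matrix_mult_complexify:
  shows "cvec x v* complexify M = cvec (x v* M)"
    and "Re_vec (z v* complexify M) = Re_vec z v* M"
    and "Im_vec (z v* complexify M) = Im_vec z v* M"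
  by (simp_all add: cvec_def Re_vec_def Im_vec_def vec_eq_iff vector_matrix_mult_def)

text \<open>Multiplication by a real matrix commutes with the embedding of real rows and with taking
  real and imaginary parts, so the rows killed by all blocks are trivial over both fields or over
  neither.\<close>

lemma controllable_pair_complexify:
  "controllable_pair (complexify A) (complexify B) \<longleftrightarrow> controllable_pair A B"
  for A :: "real^'d^'d" and B :: "real^'m^'d"
proof
  assume c: "controllable_pair (complexify A) (complexify B)"
  show "controllable_pair A B"
    unfolding controllable_pair_iff
  proof (intro allI impI)
    fix x :: "real^'d" assume "\<forall>j<CARD('d). x v* (mat_power A j ** B) = 0"
    then have "\<forall>j<CARD('d). cvec x v* (mat_power (complexify A) j ** complexify B) = 0"
      by (simp add: complexify_mat_power[symmetric] complexify_mult[symmetric] vector_matrix_mult_complexify)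
    with c have "cvec x = 0" unfolding controllable_pair_iff by blast
    then show "x = 0" by simp
  qed
next
  assume c: "controllable_pair A B"
  show "controllable_pair (complexify A) (complexify B)"
    unfolding controllable_pair_iff
  proof (intro allI impI)
    fix z :: "complex^'d"
    assume z: "\<forall>j<CARD('d). z v* (mat_power (complexify A) j ** complexify B) = 0"
    have "Re_vec z v* (mat_power A j ** B) = 0 \<and> Im_vec z v* (mat_power A j ** B) = 0"
      if "j < CARD('d)" for j
      using z that
      by (simp add: complexify_mat_power[symmetric] complexify_mult[symmetric]
          vector_matrix_mult_complexify[symmetric]) (simp add: Re_vec_def Im_vec_def vec_eq_iff)
    with c have "Re_vec z = 0" "Im_vec z = 0" unfolding controllable_pair_iff by blast+
    then show "z = 0" by (rule Re_Im_vec_eq_0)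
  qed
qed

text \<open>From a complex row \<open>z\<close> one passes to \<open>Re_vec z\<close> and
  \<open>Im_vec z\<close>: their outputs are dominated by that of \<open>z\<close>, and at least one
  of them is nonzero.\<close>

lemma no_summable_iff_real:
  fixes A :: "real^'d^'d" and B :: "real^'m^'d"
  shows "(\<nexists>x. x \<noteq> 0 \<and> summable (\<lambda>j. norm (x v* (mat_power A j ** B)))) \<longleftrightarrow>
    controllable_pair A B \<and> (\<nexists>\<mu>. is_eigenvalue (complexify A) \<mu> \<and> cmod \<mu> < 1)"
proof -
  let ?M = "\<lambda>j. mat_power A j ** B"
  have M: "mat_power (complexify A) j ** complexify B = complexify (?M j)" for j
    by (simp add: complexify_mult complexify_mat_power)
  have "\<exists>z. z \<noteq> 0 \<and> summable (\<lambda>j. norm (z v* complexify (?M j)))"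
    if "x \<noteq> 0" "summable (\<lambda>j. norm (x v* ?M j))" for x
    using that by (intro exI[of _ "cvec x"]) (simp add: vector_matrix_mult_complexify)
  moreover have "\<exists>x. x \<noteq> 0 \<and> summable (\<lambda>j. norm (x v* ?M j))"
    if z: "z \<noteq> 0" "summable (\<lambda>j. norm (z v* complexify (?M j)))" for z
  proof -
    have "summable (\<lambda>j. norm (Re_vec z v* ?M j))"
      by (rule summable_comparison_test'[OF z(2), where N = 0])
        (simp add: vector_matrix_mult_complexify[symmetric] norm_Re_vec_le)
    moreover have "summable (\<lambda>j. norm (Im_vec z v* ?M j))"
      by (rule summable_comparison_test'[OF z(2), where N = 0])
        (simp add: vector_matrix_mult_complexify[symmetric] norm_Im_vec_le)
    ultimately show ?thesis using Re_Im_vec_eq_0 z(1) by blast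
  qed
  ultimately have "(\<exists>x. x \<noteq> 0 \<and> summable (\<lambda>j. norm (x v* ?M j))) \<longleftrightarrow>
      (\<exists>z. z \<noteq> 0 \<and> summable (\<lambda>j. norm (z v* complexify (?M j))))" by blast
  then show ?thesis
    using no_summable_iff_complex[of "complexify A" "complexify B"]
    by (simp only: M controllable_pair_complexify)
qed

section \<open>Sums of linear images of a bounded convex set\<close>

lemma proper_convex_bounded_functional:
  fixes S :: "'v::euclidean_space set"
  assumes "convex S" "S \<noteq> {}" "p \<notin> S"
  obtains \<xi> c where "\<xi> \<noteq> 0" "\<forall>x\<in>S. \<xi> \<bullet> x \<le> c"
  using separating_hyperplane_sets[OF assms(1) convex_singleton[of p] assms(2)] assms(3) by auto

text \<open>If \<open>U\<close> lies in a ball of radius \<open>b\<close> and contains one of radius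
  \<open>r\<close>, the supremum of \<open>\<xi>\<close> over the sums lies between \<open>r\<close>
  and \<open>b\<close> times the series of \<open>norm (adjoint (F i) \<xi>)\<close>. Working in
  Euclidean spaces with the real inner product covers both fields at once.\<close>

lemma sum_images_eq_UNIV_iff:
  fixes F :: "nat \<Rightarrow> 'u::euclidean_space \<Rightarrow> 'v::euclidean_space"
  assumes lin: "\<And>i. linear (F i)" and "bounded U" "convex U" "0 \<in> interior U"
  shows "{\<Sum>i<k. F i (u i) | k u. k \<ge> (1::nat) \<and> u \<in> UNIV \<rightarrow> U} = UNIV \<longleftrightarrow>
    (\<nexists>\<xi>. \<xi> \<noteq> 0 \<and> summable (\<lambda>i. norm (adjoint (F i) \<xi>)))"
    (is "?S = UNIV \<longleftrightarrow> ?R")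
proof -
  have "0 \<in> U" using assms(4) interior_subset by blast
  have inner_sum: "\<xi> \<bullet> (\<Sum>i<k. F i (u i)) = (\<Sum>i<k. adjoint (F i) \<xi> \<bullet> u i)" for \<xi> k u
    by (simp add: inner_sum_right adjoint_clauses(2)[OF lin])
  \<comment> \<open>Appending the control \<open>0\<close> prolongs a sum without changing it. Sums
    of lengths \<open>k\<close> and \<open>l\<close> can thus be combined convexly at the common
    length \<open>k + l\<close>.\<close>
  have pad: "\<exists>w\<in>UNIV \<rightarrow> U. (\<forall>l\<ge>k. (\<Sum>i<l. F i (w i)) = (\<Sum>i<k. F i (u i)))"
    if "u \<in> UNIV \<rightarrow> U" for u k
  proof (intro bexI allI impI)
    let ?w = "\<lambda>i. if i < k then u i else 0"
    show "?w \<in> UNIV \<rightarrow> U" using that \<open>0 \<in> U\<close> by auto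
    fix l assume "k \<le> l"
    then show "(\<Sum>i<l. F i (?w i)) = (\<Sum>i<k. F i (u i))"
      by (intro sum.mono_neutral_cong_right) (auto simp: linear_0[OF lin])
  qed
  have "convex ?S"
  proof (rule convexI)
    fix x y :: 'v and a b :: real
    assume x: "x \<in> ?S" and y: "y \<in> ?S" and ab: "0 \<le> a" "0 \<le> b" "a + b = 1"
    obtain k u where k: "k \<ge> 1" and u: "u \<in> UNIV \<rightarrow> U" and xu: "x = (\<Sum>i<k. F i (u i))"
      using x by blast
    obtain l w where w: "w \<in> UNIV \<rightarrow> U" and yw: "y = (\<Sum>i<l. F i (w i))"
      using y by blast
    obtain u' where u': "u' \<in> UNIV \<rightarrow> U" "\<forall>m\<ge>k. (\<Sum>i<m. F i (u' i)) = x"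
      using pad[OF u] xu by blast
    obtain w' where w': "w' \<in> UNIV \<rightarrow> U" "\<forall>m\<ge>l. (\<Sum>i<m. F i (w' i)) = y"
      using pad[OF w] yw by blast
    have "(\<Sum>i<k+l. F i (a *\<^sub>R u' i + b *\<^sub>R w' i)) = a *\<^sub>R x + b *\<^sub>R y"
      using u'(2)[rule_format, of "k + l"] w'(2)[rule_format, of "k + l"]
      by (simp add: linear_add[OF lin] linear_cmul[OF lin] sum.distrib scaleR_sum_right[symmetric])
    moreover have "(\<lambda>i. a *\<^sub>R u' i + b *\<^sub>R w' i) \<in> UNIV \<rightarrow> U"
      using u' w' ab by (auto simp: Pi_iff intro!: convexD[OF \<open>convex U\<close>])
    moreover have "k + l \<ge> 1" using k by simp
    ultimately show "a *\<^sub>R x + b *\<^sub>R y \<in> ?S"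
      by (intro CollectI exI[of _ "k + l"] exI[of _ "\<lambda>i. a *\<^sub>R u' i + b *\<^sub>R w' i"]) simp
  qed
  show ?thesis
  proof
    assume S: "?S = UNIV"
    show ?R
    proof safe
      fix \<xi> :: 'v assume "\<xi> \<noteq> 0" and sum: "summable (\<lambda>i. norm (adjoint (F i) \<xi>))"
      obtain b where b: "\<And>u. u \<in> U \<Longrightarrow> norm u \<le> b" "b > 0"
        using \<open>bounded U\<close> by (auto simp: bounded_pos)
      define c where "c = b * (\<Sum>i. norm (adjoint (F i) \<xi>))"
      have bound: "\<xi> \<bullet> x \<le> c" for x
      proof -
        have "x \<in> ?S" using S by blast
        then obtain k u where u: "u \<in> UNIV \<rightarrow> U" and x: "x = (\<Sum>i<k. F i (u i))"
          by blast
        have "\<xi> \<bullet> x = (\<Sum>i<k. adjoint (F i) \<xi> \<bullet> u i)" by (simp add: x inner_sum)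
        also have "\<dots> \<le> (\<Sum>i<k. norm (adjoint (F i) \<xi>) * b)"
        proof (rule sum_mono)
          fix i
          have "adjoint (F i) \<xi> \<bullet> u i \<le> norm (adjoint (F i) \<xi>) * norm (u i)"
            by (rule norm_cauchy_schwarz)
          also have "\<dots> \<le> norm (adjoint (F i) \<xi>) * b"
            using b u by (intro mult_left_mono) auto
          finally show "adjoint (F i) \<xi> \<bullet> u i \<le> norm (adjoint (F i) \<xi>) * b" .
        qed
        also have "\<dots> = b * (\<Sum>i<k. norm (adjoint (F i) \<xi>))"
          by (simp add: sum_distrib_left mult.commute)
        also have "\<dots> \<le> c"
          unfolding c_def using sum b by (intro mult_left_mono sum_le_suminf) auto
        finally show ?thesis .
      qed
      \<comment> \<open>A nonzero functional is unbounded: this multiple of \<open>\<xi>\<close>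
        takes it above the bound \<open>c\<close>.\<close>
      have "\<xi> \<bullet> (((c + 1) / (\<xi> \<bullet> \<xi>)) *\<^sub>R \<xi>) = c + 1"
        using \<open>\<xi> \<noteq> 0\<close> by simp
      with bound[of "((c + 1) / (\<xi> \<bullet> \<xi>)) *\<^sub>R \<xi>"] show False by simp
    qed
  next
    assume R: ?R
    show "?S = UNIV"
    proof (rule ccontr)
      assume "?S \<noteq> UNIV"
      then obtain p where p: "p \<notin> ?S" by blast
      have "(\<Sum>i<1. F i 0) \<in> ?S" using \<open>0 \<in> U\<close> by fastforce
      then have "?S \<noteq> {}" by blast
      from proper_convex_bounded_functional[OF \<open>convex ?S\<close> this p]
      obtain \<xi> c where sep: "\<xi> \<noteq> 0" "\<forall>x\<in>?S. \<xi> \<bullet> x \<le> c" .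
      obtain r where r: "r > 0" "cball 0 r \<subseteq> U"
        using assms(4) by (auto simp: mem_interior_cball)
      \<comment> \<open>The control of length at most \<open>r\<close> that makes the
        \<open>i\<close>-th term largest, by the equality case of Cauchy-Schwarz. As
        \<open>sgn 0 = 0\<close>, a vanishing adjoint image gives the control
        \<open>0\<close>.\<close>
      define u where "u i = r *\<^sub>R sgn (adjoint (F i) \<xi>)" for i
      have u: "u \<in> UNIV \<rightarrow> U"
        using r by (auto simp: u_def norm_sgn intro!: subsetD[OF r(2)])
      have inner_u: "adjoint (F i) \<xi> \<bullet> u i = r * norm (adjoint (F i) \<xi>)" for i
        by (cases "adjoint (F i) \<xi> = 0")
          (simp_all add: u_def sgn_div_norm dot_square_norm power2_eq_square)
      have "(\<Sum>i<k. r * norm (adjoint (F i) \<xi>)) \<le> c" if "k \<ge> 1" for k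
      proof -
        have "(\<Sum>i<k. r * norm (adjoint (F i) \<xi>)) = \<xi> \<bullet> (\<Sum>i<k. F i (u i))"
          by (simp add: inner_sum inner_u)
        also have "\<dots> \<le> c" using u that by (intro sep(2)[rule_format]) blast
        finally show ?thesis .
      qed
      from this[of "Suc _"] have "(\<Sum>i\<le>k. norm (adjoint (F i) \<xi>)) \<le> c / r" for k
        using r by (simp add: sum_distrib_left[symmetric] field_simps lessThan_Suc_atMost
            del: sum.lessThan_Suc)
      then have "summable (\<lambda>i. norm (adjoint (F i) \<xi>))"
        by (intro bounded_imp_summable) auto
      with R sep(1) show False by blast
    qed
  qed
qed

lemma norm_adjoint_real_matrix:
  fixes M :: "real^'m^'n"
  shows "norm (adjoint ((*v) M) x) = norm (x v* M)"
  by (simp add: adjoint_matrix)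

text \<open>The real inner product is the real part of the Hermitian one, so the adjoint is the
  conjugate transpose. Writing it with the bilinear row product conjugates input and output; the
  outer conjugation preserves the norm.\<close>

lemma norm_adjoint_complex_matrix:
  fixes M :: "complex^'m^'n"
  shows "norm (adjoint ((*v) M) x) = norm ((\<chi> i. cnj (x $ i)) v* M)"
proof -
  let ?g = "\<lambda>y. \<chi> j. cnj (((\<chi> i. cnj (y $ i)) v* M) $ j)"
  have "adjoint ((*v) M) = ?g"
  proof (rule adjoint_unique, intro allI)
    fix x :: "complex^'m" and y :: "complex^'n"
    have inner: "a \<bullet> b = Re (a * cnj b)" for a b :: complex
      by (simp add: inner_complex_def)
    have "(M *v x) \<bullet> y = Re (\<Sum>i\<in>UNIV. \<Sum>j\<in>UNIV. M $ i $ j * x $ j * cnj (y $ i))"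
      by (simp only: inner_vec_def inner matrix_vector_mult_def vec_lambda_beta sum_distrib_right Re_sum)
    also have "\<dots> = Re (\<Sum>j\<in>UNIV. \<Sum>i\<in>UNIV. M $ i $ j * x $ j * cnj (y $ i))"
      by (subst sum.swap) (rule refl)
    also have "\<dots> = x \<bullet> ?g y"
      by (simp only: inner_vec_def inner vector_matrix_mult_def vec_lambda_beta sum_distrib_left
          Re_sum complex_cnj_cnj mult_ac)
    finally show "(M *v x) \<bullet> y = x \<bullet> ?g y" .
  qed
  then show ?thesis by (simp add: norm_vec_def)
qed

section \<open>Reachability and controllability\<close>

text \<open>Reading the controls backwards turns the exponent \<open>k - 1 - i\<close> into
  \<open>i\<close>. The map applied to the \<open>i\<close>-th control then no longer depends on
  \<open>k\<close>.\<close>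

lemma reachable_set_eq:
  fixes A :: "'k::field^'d^'d" and B :: "'k^'m^'d"
  shows "reachable_set A B U =
    {\<Sum>i<k. (mat_power A i ** B) *v u i | k u. k \<ge> (1::nat) \<and> u \<in> UNIV \<rightarrow> U}"
proof -
  have reverse: "(\<Sum>i<k. (mat_power A (k - Suc i) ** B) *v u i)
      = (\<Sum>i<k. (mat_power A i ** B) *v u (k - Suc i))" for k and u :: "nat \<Rightarrow> 'k^'m"
    by (rule sum.reindex_bij_witness[of _ "\<lambda>i. k - Suc i" "\<lambda>i. k - Suc i"]) auto
  show ?thesis (is "_ = ?S")
  proof (intro equalityI subsetI)
    fix x assume "x \<in> reachable_set A B U"
    then obtain k u where "k \<ge> 1" "u \<in> UNIV \<rightarrow> U" "x = solution A B k 0 u"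
      by (auto simp: reachable_set_def control_seqs_def)
    then show "x \<in> ?S"
      by (intro CollectI exI[of _ k] exI[of _ "\<lambda>i. u (k - Suc i)"])
        (auto simp: solution_def matrix_vector_mul_assoc reverse)
  next
    fix x assume "x \<in> ?S"
    then obtain k u where "k \<ge> 1" "u \<in> UNIV \<rightarrow> U" "x = (\<Sum>i<k. (mat_power A i ** B) *v u i)"
      by blast
    then show "x \<in> reachable_set A B U"
      unfolding reachable_set_def control_seqs_def
      by (intro CollectI exI[of _ k] exI[of _ "\<lambda>i. u (k - Suc i)"])
        (auto simp: solution_def matrix_vector_mul_assoc reverse)
  qed
qed

text \<open>Applying \<open>A'^k\<close> to \<open>solution A B k y u = 0\<close> isolates
  \<open>y\<close> as the sum of \<open>A'^(i + 1) B (- u i)\<close> over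
  \<open>i < k\<close>.\<close>

lemma null_controllable_set_eq_reachable_set:
  fixes A :: "'k::field^'d^'d" and B :: "'k^'m^'d"
  assumes "A' ** A = mat 1"
  shows "null_controllable_set A B U = reachable_set A' (A' ** B) (uminus ` U)"
proof -
  have A: "A ** A' = mat 1" using assms matrix_left_right_inverse by blast
  have inv: "mat_power A' k *v (mat_power A k *v y) = y"
    "mat_power A k *v (mat_power A' k *v y) = y" for k y
    by (simp_all add: matrix_vector_mul_assoc mat_power_inverse assms A)
  have kernel: "mat_power A k *v z = 0 \<longleftrightarrow> z = 0" for k z
    using inv(1)[of k z] by auto
  have null: "solution A B k y u = 0 \<longleftrightarrow> y = (\<Sum>i<k. (mat_power A' i ** (A' ** B)) *v (- u i))"
    for k y u
  proof -
    have "mat_power A k *v ((mat_power A' i ** (A' ** B)) *v u i)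
        = mat_power A (k - 1 - i) *v (B *v u i)" if "i < k" for i
    proof -
      have "k = (k - 1 - i) + Suc i" using that by simp
      then have "mat_power A k = mat_power A (k - 1 - i) ** mat_power A (Suc i)"
        by (metis mat_power_add)
      moreover have "mat_power A' i ** (A' ** B) = mat_power A' (Suc i) ** B"
        by (simp add: mat_power_Suc_right matrix_mul_assoc del: mat_power.simps)
      ultimately show ?thesis
        using inv(2)[of "Suc i"]
        by (simp add: matrix_vector_mul_assoc[symmetric] del: mat_power.simps)
    qed
    then have "mat_power A k *v (\<Sum>i<k. (mat_power A' i ** (A' ** B)) *v u i)
        = (\<Sum>i<k. mat_power A (k - 1 - i) *v (B *v u i))"
      by (simp add: vec.sum)
    then have "solution A B k y u
        = mat_power A k *v (y + (\<Sum>i<k. (mat_power A' i ** (A' ** B)) *v u i))"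
      by (simp add: solution_def matrix_vector_right_distrib)
    then have "solution A B k y u = 0 \<longleftrightarrow> y + (\<Sum>i<k. (mat_power A' i ** (A' ** B)) *v u i) = 0"
      by (simp only: kernel)
    then show ?thesis
      by (simp add: vec.neg sum_negf eq_neg_iff_add_eq_0)
  qed
  have "y \<in> null_controllable_set A B U \<longleftrightarrow> y \<in> reachable_set A' (A' ** B) (uminus ` U)" for y
  proof
    assume "y \<in> null_controllable_set A B U"
    then obtain k u where "k \<ge> 1" "u \<in> UNIV \<rightarrow> U" "solution A B k y u = 0"
      by (auto simp: null_controllable_set_def control_seqs_def)
    then show "y \<in> reachable_set A' (A' ** B) (uminus ` U)"
      unfolding reachable_set_eq null
      by (intro CollectI exI[of _ k] exI[of _ "\<lambda>i. - u i"]) auto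
  next
    assume "y \<in> reachable_set A' (A' ** B) (uminus ` U)"
    then obtain k w where "k \<ge> 1" "w \<in> UNIV \<rightarrow> uminus ` U"
      "y = (\<Sum>i<k. (mat_power A' i ** (A' ** B)) *v w i)"
      unfolding reachable_set_eq by blast
    then show "y \<in> null_controllable_set A B U"
      unfolding null_controllable_set_def control_seqs_def
      by (intro CollectI exI[of _ k] conjI bexI[of _ "\<lambda>i. - w i"])
        (auto simp: null Pi_iff image_iff, metis minus_minus)
  qed
  then show ?thesis by blast
qed

lemma solution_Suc:
  fixes A :: "'k::field^'d^'d"
  shows "solution A B (Suc k) x u = A *v solution A B k x u + B *v u k"
proof -
  have "(\<Sum>i<k. mat_power A (k - i) *v (B *v u i))
      = A *v (\<Sum>i<k. mat_power A (k - 1 - i) *v (B *v u i))"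
    unfolding vec.sum
  proof (rule sum.cong)
    fix i assume "i \<in> {..<k}"
    then have "k - i = Suc (k - 1 - i)" by auto
    then show "mat_power A (k - i) *v (B *v u i) = A *v (mat_power A (k - 1 - i) *v (B *v u i))"
      by (simp add: matrix_vector_mul_assoc matrix_mul_assoc)
  qed simp
  then show ?thesis
    by (simp add: solution_def matrix_vector_right_distrib matrix_vector_mul_assoc)
qed

lemma solution_add:
  fixes A :: "'k::field^'d^'d"
  shows "solution A B (k + l) x u = solution A B l (solution A B k x u) (\<lambda>i. u (k + i))"
proof (induction l)
  case 0
  show ?case by (simp add: solution_def)
next
  case (Suc l)
  then show ?case by (simp add: solution_Suc)
qed

lemma system_controllable_iff:
  fixes A :: "'k::field^'d^'d"
  shows "system_controllable A B U \<longleftrightarrow>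
    reachable_set A B U = UNIV \<and> null_controllable_set A B U = UNIV"
proof
  assume "system_controllable A B U"
  then show "reachable_set A B U = UNIV \<and> null_controllable_set A B U = UNIV"
    unfolding system_controllable_def reachable_set_def null_controllable_set_def
    by (auto simp: set_eq_iff) metis+
next
  assume RC: "reachable_set A B U = UNIV \<and> null_controllable_set A B U = UNIV"
  show "system_controllable A B U"
    unfolding system_controllable_def
  proof (intro allI)
    fix x y
    have "x \<in> null_controllable_set A B U" "y \<in> reachable_set A B U" using RC by blast+
    then obtain k u l w where k: "k \<ge> 1" "u \<in> control_seqs U" "solution A B k x u = 0"
      and l: "w \<in> control_seqs U" "y = solution A B l 0 w"
      unfolding null_controllable_set_def reachable_set_def by blast
    \<comment> \<open>Steer \<open>x\<close> to \<open>0\<close> in \<open>k\<close> steps, then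
      restart from \<open>0\<close> with \<open>w\<close> delayed by \<open>k\<close>. The state at
      time \<open>k\<close> depends only on the controls before \<open>k\<close>.\<close>
    let ?u = "\<lambda>i. if i < k then u i else w (i - k)"
    have "solution A B k x ?u = solution A B k x u" by (simp add: solution_def)
    then have "solution A B (k + l) x ?u = y" using k l by (simp add: solution_add)
    moreover have "?u \<in> control_seqs U" using k l by (auto simp: control_seqs_def Pi_iff)
    moreover have "k + l \<ge> 1" using k by simp
    ultimately show "\<exists>u\<in>control_seqs U. \<exists>k\<ge>1. solution A B k x u = y" by blast
  qed
qed

lemma left_eigenvector_inverse:
  fixes A :: "'k::field^'d^'d"
  assumes "A ** A' = mat 1" "v \<noteq> 0" "v v* A = \<mu> *s v"
  shows "\<mu> \<noteq> 0" "v v* A' = inverse \<mu> *s v"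
proof -
  have v: "v = \<mu> *s (v v* A')"
    by (metis assms(1,3) vector_matrix_mul_assoc vector_matrix_mul_rid vector_matrix_mult_scale)
  with assms(2) show \<mu>: "\<mu> \<noteq> 0" by auto
  have "inverse \<mu> *s v = inverse \<mu> *s (\<mu> *s (v v* A'))" using v by simp
  with \<mu> show "v v* A' = inverse \<mu> *s v" by simp
qed

text \<open>\<open>A\<close> and \<open>A'\<close> share their left eigenvectors, with inverse
  eigenvalues, and \<open>v A' B\<close> is a nonzero multiple of \<open>v B\<close>; so both pairs
  pass the Hautus test together.\<close>

lemma controllable_pair_inverse:
  fixes A :: "complex^'d^'d" and B :: "complex^'m^'d"
  assumes "A ** A' = mat 1"
  shows "controllable_pair A' (A' ** B) \<longleftrightarrow> controllable_pair A B"
proof -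
  have dir: "controllable_pair C D"
    if "controllable_pair C' (C' ** D)" "C ** C' = mat 1" for C C' and D :: "complex^'m^'d"
    unfolding hautus
  proof safe
    fix v \<mu> assume v: "v \<noteq> 0" "v v* C = \<mu> *s v" "v v* D = 0"
    have "v v* (C' ** D) = 0"
      using left_eigenvector_inverse[OF that(2) v(1,2)] v(3)
      by (simp add: vector_matrix_mul_assoc[symmetric] vector_matrix_mult_scale)
    with that(1) left_eigenvector_inverse[OF that(2) v(1,2)] v(1) show False
      unfolding hautus by blast
  qed
  have A': "A' ** A = mat 1" using assms matrix_left_right_inverse by blast
  show ?thesis
    \<comment> \<open>The second instance exchanges the roles of \<open>A\<close> and
      \<open>A'\<close> and takes \<open>A' ** B\<close> for \<open>D\<close>, using
      \<open>A ** (A' ** B) = B\<close>.\<close>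
    using dir[of A' B A] dir[of A "A' ** B" A'] assms A' by (auto simp: matrix_mul_assoc)
qed

lemma is_eigenvalue_inverse:
  fixes A :: "complex^'d^'d"
  assumes "A ** A' = mat 1"
  shows "(\<exists>\<mu>. is_eigenvalue A' \<mu> \<and> cmod \<mu> < 1) \<longleftrightarrow> (\<exists>\<mu>. is_eigenvalue A \<mu> \<and> cmod \<mu> > 1)"
proof -
  have A': "A' ** A = mat 1" using assms matrix_left_right_inverse by blast
  show ?thesis
    unfolding is_eigenvalue_iff_left
  proof safe
    fix v \<mu> assume v: "v \<noteq> 0" "v v* A' = \<mu> *s v" "cmod \<mu> < 1"
    then have "cmod (inverse \<mu>) > 1"
      using left_eigenvector_inverse(1)[OF A' v(1,2)] by (simp add: norm_inverse one_less_inverse_iff)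
    with v left_eigenvector_inverse(2)[OF A' v(1,2)]
    show "\<exists>\<mu>. (\<exists>v. v \<noteq> 0 \<and> v v* A = \<mu> *s v) \<and> cmod \<mu> > 1" by blast
  next
    fix v \<mu> assume v: "v \<noteq> 0" "v v* A = \<mu> *s v" "cmod \<mu> > 1"
    then have "cmod (inverse \<mu>) < 1" by (simp add: norm_inverse inverse_less_1_iff)
    with v left_eigenvector_inverse(2)[OF assms v(1,2)]
    show "\<exists>\<mu>. (\<exists>v. v \<noteq> 0 \<and> v v* A' = \<mu> *s v) \<and> cmod \<mu> < 1" by blast
  qed
qed

lemma zero_in_interior_uminus:
  fixes U :: "'a::euclidean_space set"
  shows "0 \<in> interior U \<Longrightarrow> 0 \<in> interior (uminus ` U)"
  by (auto simp: interior_negations image_iff)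

lemma reachable_set_eq_UNIV_iff_complex:
  fixes A :: "complex^'d^'d" and B :: "complex^'m^'d"
  assumes "bounded U" "convex U" "0 \<in> interior U"
  shows "reachable_set A B U = UNIV \<longleftrightarrow>
    controllable_pair A B \<and> (\<nexists>\<mu>. is_eigenvalue A \<mu> \<and> cmod \<mu> < 1)"
proof -
  let ?cnj = "\<lambda>x :: complex^'d. \<chi> i. cnj (x $ i)"
  let ?Q = "\<lambda>x. x \<noteq> 0 \<and> summable (\<lambda>j. norm (x v* (mat_power A j ** B)))"
  have cnj_cnj: "?cnj (?cnj x) = x" and cnj_0: "?cnj x = 0 \<longleftrightarrow> x = 0" for x
    by (simp_all add: vec_eq_iff)
  have "reachable_set A B U = UNIV \<longleftrightarrow>
      (\<nexists>x. x \<noteq> 0 \<and> summable (\<lambda>j. norm (?cnj x v* (mat_power A j ** B))))"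
    unfolding reachable_set_eq
    by (subst sum_images_eq_UNIV_iff[OF _ assms])
      (simp_all add: norm_adjoint_complex_matrix matrix_vector_mul_linear)
  also have "\<dots> \<longleftrightarrow> (\<nexists>x. ?Q (?cnj x))" by (simp add: cnj_0)
  \<comment> \<open>Conjugation is an involution, so quantifying over \<open>?cnj x\<close> is
    quantifying over \<open>x\<close>.\<close>
  also have "\<dots> \<longleftrightarrow> (\<nexists>x. ?Q x)" by (metis cnj_cnj)
  finally show ?thesis unfolding no_summable_iff_complex .
qed

lemma reachable_set_eq_UNIV_iff_real:
  fixes A :: "real^'d^'d" and B :: "real^'m^'d"
  assumes "bounded U" "convex U" "0 \<in> interior U"
  shows "reachable_set A B U = UNIV \<longleftrightarrow>
    controllable_pair A B \<and> (\<nexists>\<mu>. is_eigenvalue (complexify A) \<mu> \<and> cmod \<mu> < 1)"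
  unfolding reachable_set_eq no_summable_iff_real[symmetric]
  by (subst sum_images_eq_UNIV_iff[OF _ assms])
    (simp_all add: norm_adjoint_real_matrix matrix_vector_mul_linear)

lemma null_controllable_set_eq_UNIV_iff_complex:
  fixes A :: "complex^'d^'d" and B :: "complex^'m^'d"
  assumes "invertible A" "bounded U" "convex U" "0 \<in> interior U"
  shows "null_controllable_set A B U = UNIV \<longleftrightarrow>
    controllable_pair A B \<and> (\<nexists>\<mu>. is_eigenvalue A \<mu> \<and> cmod \<mu> > 1)"
proof -
  obtain A' where A': "A ** A' = mat 1" "A' ** A = mat 1"
    using assms(1) by (auto simp: invertible_def)
  have "reachable_set A' (A' ** B) (uminus ` U) = UNIV \<longleftrightarrow>
      controllable_pair A' (A' ** B) \<and> (\<nexists>\<mu>. is_eigenvalue A' \<mu> \<and> cmod \<mu> < 1)"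
    using assms
    by (intro reachable_set_eq_UNIV_iff_complex)
      (simp_all add: convex_negations zero_in_interior_uminus)
  then show ?thesis
    by (simp only: null_controllable_set_eq_reachable_set[OF A'(2)]
        controllable_pair_inverse[OF A'(1)] is_eigenvalue_inverse[OF A'(1)])
qed

lemma null_controllable_set_eq_UNIV_iff_real:
  fixes A :: "real^'d^'d" and B :: "real^'m^'d"
  assumes "invertible A" "bounded U" "convex U" "0 \<in> interior U"
  shows "null_controllable_set A B U = UNIV \<longleftrightarrow>
    controllable_pair A B \<and> (\<nexists>\<mu>. is_eigenvalue (complexify A) \<mu> \<and> cmod \<mu> > 1)"
proof -
  obtain A' where A': "A ** A' = mat 1" "A' ** A = mat 1"
    using assms(1) by (auto simp: invertible_def)
  \<comment> \<open>The facts on inverses rest on complex left eigenvectors, so the real pair is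
    compared with its inverse after complexification.\<close>
  have c: "complexify A ** complexify A' = mat 1"
    by (simp add: complexify_mult[symmetric] A' complexify_mat_1)
  have "controllable_pair A' (A' ** B) \<longleftrightarrow> controllable_pair A B"
    using controllable_pair_inverse[OF c, of "complexify B"]
    by (simp add: complexify_mult[symmetric] controllable_pair_complexify)
  moreover have "reachable_set A' (A' ** B) (uminus ` U) = UNIV \<longleftrightarrow>
      controllable_pair A' (A' ** B) \<and> (\<nexists>\<mu>. is_eigenvalue (complexify A') \<mu> \<and> cmod \<mu> < 1)"
    using assms
    by (intro reachable_set_eq_UNIV_iff_real)
      (simp_all add: convex_negations zero_in_interior_uminus)
  ultimately show ?thesis
    by (simp only: null_controllable_set_eq_reachable_set[OF A'(2)] is_eigenvalue_inverse[OF c])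
qed

theorem corollary16:
  fixes A\<^sub>r :: "real^'d^'d" and B\<^sub>r :: "real^'m^'d" and U\<^sub>r :: "(real^'m) set"
    and A\<^sub>c :: "complex^'d^'d" and B\<^sub>c :: "complex^'m^'d" and U\<^sub>c :: "(complex^'m) set"
  shows
    "(invertible A\<^sub>r \<and> compact U\<^sub>r \<and> convex U\<^sub>r \<and> 0 \<in> interior U\<^sub>r \<and> U\<^sub>r = closure (interior U\<^sub>r) \<longrightarrow>
       (reachable_set A\<^sub>r B\<^sub>r U\<^sub>r = UNIV \<longleftrightarrow>
          controllable_pair A\<^sub>r B\<^sub>r \<and> (\<nexists>\<mu>. is_eigenvalue (complexify A\<^sub>r) \<mu> \<and> cmod \<mu> < 1)) \<and>
       (null_controllable_set A\<^sub>r B\<^sub>r U\<^sub>r = UNIV \<longleftrightarrow>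
          controllable_pair A\<^sub>r B\<^sub>r \<and> (\<nexists>\<mu>. is_eigenvalue (complexify A\<^sub>r) \<mu> \<and> cmod \<mu> > 1)) \<and>
       (system_controllable A\<^sub>r B\<^sub>r U\<^sub>r \<longleftrightarrow>
          controllable_pair A\<^sub>r B\<^sub>r \<and> (\<forall>\<mu>. is_eigenvalue (complexify A\<^sub>r) \<mu> \<longrightarrow> cmod \<mu> = 1)))
     \<and>
     (invertible A\<^sub>c \<and> compact U\<^sub>c \<and> convex U\<^sub>c \<and> 0 \<in> interior U\<^sub>c \<and> U\<^sub>c = closure (interior U\<^sub>c) \<longrightarrow>
       (reachable_set A\<^sub>c B\<^sub>c U\<^sub>c = UNIV \<longleftrightarrow>
          controllable_pair A\<^sub>c B\<^sub>c \<and> (\<nexists>\<mu>. is_eigenvalue A\<^sub>c \<mu> \<and> cmod \<mu> < 1)) \<and>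
       (null_controllable_set A\<^sub>c B\<^sub>c U\<^sub>c = UNIV \<longleftrightarrow>
          controllable_pair A\<^sub>c B\<^sub>c \<and> (\<nexists>\<mu>. is_eigenvalue A\<^sub>c \<mu> \<and> cmod \<mu> > 1)) \<and>
       (system_controllable A\<^sub>c B\<^sub>c U\<^sub>c \<longleftrightarrow>
          controllable_pair A\<^sub>c B\<^sub>c \<and> (\<forall>\<mu>. is_eigenvalue A\<^sub>c \<mu> \<longrightarrow> cmod \<mu> = 1)))"
proof -
  \<comment> \<open>Absolute value \<open>1\<close> means neither below nor above \<open>1\<close>;
    hence the third equivalence is the conjunction of the first two.\<close>
  have unit: "(\<forall>\<mu>. P \<mu> \<longrightarrow> cmod \<mu> = 1) \<longleftrightarrow>
      (\<nexists>\<mu>. P \<mu> \<and> cmod \<mu> < 1) \<and> (\<nexists>\<mu>. P \<mu> \<and> cmod \<mu> > 1)" for P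
    by (metis less_irrefl linorder_neqE)
  show ?thesis
    unfolding system_controllable_iff unit
    using reachable_set_eq_UNIV_iff_real[of U\<^sub>r A\<^sub>r B\<^sub>r]
      null_controllable_set_eq_UNIV_iff_real[of A\<^sub>r U\<^sub>r B\<^sub>r]
      reachable_set_eq_UNIV_iff_complex[of U\<^sub>c A\<^sub>c B\<^sub>c]
      null_controllable_set_eq_UNIV_iff_complex[of A\<^sub>c U\<^sub>c B\<^sub>c]
    by (simp add: compact_imp_bounded) blast
qed

end
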